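(* Let $\omega\in(0,\tfrac18)$ and let $F=(F_x,F_y,F_z):(\mathbb{R}^3)^4\to\mathbb{R}^3$, $(P_{i-1},P_i,P_{i+1},P_{i+2})\mapsto P_{2i+1}$, be the odd-point insertion map of the Heisenberg four-point subdivision operator, where $P_j=(x_j,y_j,z_j)$. Then the sub-blocks $\partial(F_x,F_y)/\partial z_{i+r}$, $r\in\{-1,0,1,2\}$, vanish identically. The horizontal $2\times2$ diagonal blocks $\partial(F_x,F_y)/\partial(x_{i+r},y_{i+r})$ reproduce exactly the four-point mask, i.e. they equal $c_r I_2$ with $(c_{-1},c_0,c_1,c_2)=(-\omega,\tfrac12+\omega,\tfrac12+\omega,-\omega)$. Perturbations of the $z$-data do not affect the horizontal output $(F_x,F_y)$.
   Context: The odd-point insertion map $F$ of the Heisenberg four-point subdivision operator sends $P_j=(x_j,y_j,z_j)$, $j=i-1,i,i+1,i+2$, to $P_{2i+1}=(X_{2i+1},Y_{2i+1},Z_{2i+1})$ with $X_{2i+1}=-\omega x_{i-1}+(\tfrac12+\omega)x_i+(\tfrac12+\omega)x_{i+1}-\omega x_{i+2}$, $Y_{2i+1}=-\omega y_{i-1}+(\tfrac12+\omega)y_i+(\tfrac12+\omega)y_{i+1}-\omega y_{i+2}$, $Z_{2i+1}=-\omega z_{i-1}+(\tfrac12+\omega)z_i+(\tfrac12+\omega)z_{i+1}-\omega z_{i+2}+R_i$, where $R_i=\tfrac12(x_ib_i-y_ia_i)$, $a_i=X_{2i+1}-x_i$, $b_i=Y_{2i+1}-y_i$. *)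

theory Defs
  imports "HOL-Analysis.Analysis"
begin

text \<open>
  A point \<open>P = (x, y, z)\<close> is a vector of type \<^typ>\<open>real ^ 3\<close> with components
  \<open>P $ 1\<close>, \<open>P $ 2\<close>, \<open>P $ 3\<close>. A local stencil \<open>(P\<^sub>i\<^sub>-\<^sub>1, P\<^sub>i, P\<^sub>i\<^sub>+\<^sub>1, P\<^sub>i\<^sub>+\<^sub>2)\<close> has type
  \<^typ>\<open>real ^ 3 ^ 4\<close>. Its index is the offset \<open>r\<close> itself: the type \<open>4\<close> is the integers
  modulo 4, whose elements \<open>-1\<close>, \<open>0\<close>, \<open>1\<close>, \<open>2\<close> are distinct and exhaust the type, so that
  \<open>P $ r\<close> is the point \<open>P\<^sub>i\<^sub>+\<^sub>r\<close>.
\<close>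

definition four_point :: "real \<Rightarrow> (4 \<Rightarrow> real) \<Rightarrow> real" where
  "four_point \<omega> u =
     - \<omega> * u (- 1) + (1/2 + \<omega>) * u 0 + (1/2 + \<omega>) * u 1 - \<omega> * u 2"

definition odd_insertion :: "real \<Rightarrow> real ^ 3 ^ 4 \<Rightarrow> real ^ 3" where
  "odd_insertion \<omega> P =
     (let x = (\<lambda>r. P $ r $ 1); y = (\<lambda>r. P $ r $ 2); z = (\<lambda>r. P $ r $ 3);
          X = four_point \<omega> x;
          Y = four_point \<omega> y;
          a = X - x 0;
          b = Y - y 0;
          R = 1/2 * (x 0 * b - y 0 * a)
      in vector [X, Y, four_point \<omega> z + R])"

definition horizontal :: "real ^ 3 \<Rightarrow> real ^ 2" where
  "horizontal p = vector [p $ 1, p $ 2]"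

text \<open>
  Sub-blocks of the Jacobian matrix of a map \<open>G = (G\<^sub>x, G\<^sub>y, G\<^sub>z)\<close> at \<open>P\<close>:
  \<open>\<partial>(G\<^sub>x, G\<^sub>y)/\<partial>(x\<^sub>i\<^sub>+\<^sub>r, y\<^sub>i\<^sub>+\<^sub>r)\<close>, which is \<open>2 \<times> 2\<close>, and \<open>\<partial>(G\<^sub>x, G\<^sub>y)/\<partial>z\<^sub>i\<^sub>+\<^sub>r\<close>, which is
  \<open>2 \<times> 1\<close>. They are meaningful only where \<open>G\<close> is differentiable.
\<close>

definition block_xy :: "(real ^ 3 ^ 4 \<Rightarrow> real ^ 3) \<Rightarrow> real ^ 3 ^ 4 \<Rightarrow> 4 \<Rightarrow> real ^ 2 ^ 2" where
  "block_xy G P r =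
     matrix (\<lambda>v :: real ^ 2.
       horizontal (frechet_derivative G (at P) (axis r (vector [v $ 1, v $ 2, 0]))))"

definition block_z :: "(real ^ 3 ^ 4 \<Rightarrow> real ^ 3) \<Rightarrow> real ^ 3 ^ 4 \<Rightarrow> 4 \<Rightarrow> real ^ 1 ^ 2" where
  "block_z G P r =
     matrix (\<lambda>v :: real ^ 1.
       horizontal (frechet_derivative G (at P) (axis r (vector [0, 0, v $ 1]))))"

end

theory Submission
  imports Defs
begin

text \<open>
  The twist \<open>R\<close> enters only the third component of the insertion map. Its first two components
  are therefore the four-point mask applied to the \<open>x\<close>- and to the \<open>y\<close>-data separately, so that
  \<open>horizontal \<circ> odd_insertion \<omega>\<close> is a linear map
  (\<open>horizontal_odd_insertion\<close>, \<open>linear_horizontal_odd_insertion\<close>) which does not see the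
  \<open>z\<close>-data. A linear map is its own derivative, and the chain rule turns the horizontal rows of the
  Jacobian of \<open>odd_insertion \<omega>\<close>, at every stencil, into this linear map itself
  (\<open>horizontal_frechet_derivative_odd_insertion\<close>). Evaluating it on stencils supported at the
  single offset \<open>r\<close> reads off the blocks: a vertical perturbation gives \<open>0\<close>, and a horizontal one
  is scaled by the mask coefficient at \<open>r\<close>. The chain rule requires that the full map, including
  the quadratic twist, be differentiable; this holds because its components are polynomials.
\<close>

lemma four_point_zero: "four_point \<omega> (\<lambda>r. 0) = 0"
  by (simp add: four_point_def)

text \<open>
  The offsets are residues modulo 4, so evaluating the mask on a unit impulse rests on
  \<open>-1\<close>, \<open>0\<close>, \<open>1\<close>, \<open>2\<close> being pairwise distinct there.
\<close>

lemma four_point_impulse: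
  "four_point \<omega> (\<lambda>s. if s = - 1 then c else 0) = - \<omega> * c"
  "four_point \<omega> (\<lambda>s. if s = 0 then c else 0) = (1/2 + \<omega>) * c"
  "four_point \<omega> (\<lambda>s. if s = 1 then c else 0) = (1/2 + \<omega>) * c"
  "four_point \<omega> (\<lambda>s. if s = 2 then c else 0) = - \<omega> * c"
  by (simp_all add: four_point_def)

lemma horizontal_odd_insertion:
  "horizontal (odd_insertion \<omega> P) =
     vector [four_point \<omega> (\<lambda>r. P $ r $ 1), four_point \<omega> (\<lambda>r. P $ r $ 2)]"
  by (simp add: horizontal_def odd_insertion_def Let_def)

lemma bounded_linear_horizontal: "bounded_linear horizontal"
  unfolding linear_conv_bounded_linear [symmetric]
  by (rule linearI) (simp_all add: horizontal_def vec_eq_iff forall_2)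

lemma linear_horizontal_odd_insertion: "linear (\<lambda>P. horizontal (odd_insertion \<omega> P))"
  by (rule linearI)
    (simp_all add: horizontal_odd_insertion four_point_def vec_eq_iff forall_2 algebra_simps)

lemma differentiable_four_point:
  assumes "\<And>r. (\<lambda>P. u P r) differentiable (at a within S)"
  shows "(\<lambda>P. four_point \<omega> (u P)) differentiable (at a within S)"
  unfolding four_point_def using assms
  by (intro differentiable_add differentiable_diff differentiable_mult differentiable_const)

lemma differentiable_coordinate:
  "(\<lambda>P :: real ^ 'n ^ 'm. P $ r $ k) differentiable F"
  by (intro bounded_linear_imp_differentiable bounded_linear_compose [OF bounded_linear_vec_nth]
      bounded_linear_vec_nth)

lemma differentiable_odd_insertion: "odd_insertion \<omega> differentiable (at P)"
proof -
  have "(\<lambda>P. odd_insertion \<omega> P $ k) differentiable (at P)" for k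
  proof -
    have "k = 1 \<or> k = 2 \<or> k = 3"
      by (rule exhaust_3)
    then show ?thesis
      by (elim disjE; simp add: odd_insertion_def Let_def)
        (intro differentiable_add differentiable_diff differentiable_mult differentiable_divide
          differentiable_const differentiable_four_point differentiable_coordinate; simp)+
  qed
  then show ?thesis
    by (subst differentiable_componentwise_within) (auto simp: Basis_vec_def inner_axis)
qed

text \<open>
  Since the horizontal output is linear in the stencil, its derivative does not depend on the base
  stencil \<open>P\<close>; uniqueness of derivatives identifies it with the horizontal rows of the Jacobian.
\<close>

lemma horizontal_frechet_derivative_odd_insertion:
  "horizontal (frechet_derivative (odd_insertion \<omega>) (at P) V) = horizontal (odd_insertion \<omega> V)"
proof -
  have "((\<lambda>Q. horizontal (odd_insertion \<omega> Q)) has_derivative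
      (\<lambda>V. horizontal (frechet_derivative (odd_insertion \<omega>) (at P) V))) (at P)"
    using differentiable_odd_insertion [of \<omega> P]
    by (intro bounded_linear.has_derivative [OF bounded_linear_horizontal])
      (simp add: frechet_derivative_works)
  moreover have "((\<lambda>Q. horizontal (odd_insertion \<omega> Q)) has_derivative
      (\<lambda>V. horizontal (odd_insertion \<omega> V))) (at P)"
    by (intro linear_imp_has_derivative linear_horizontal_odd_insertion)
  ultimately show ?thesis
    by (metis has_derivative_unique)
qed

lemma block_z_odd_insertion: "block_z (odd_insertion \<omega>) P r = 0"
proof -
  have "(axis r (vector [0, 0, c]) :: real ^ 3 ^ 4) $ s $ 1 = 0"
    and "(axis r (vector [0, 0, c]) :: real ^ 3 ^ 4) $ s $ 2 = 0" for c s
    by (simp_all add: axis_def)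
  then show ?thesis
    by (simp add: block_z_def horizontal_frechet_derivative_odd_insertion horizontal_odd_insertion
        matrix_def vec_eq_iff forall_2 four_point_zero)
qed

text \<open>
  The mask acts on the \<open>x\<close>- and \<open>y\<close>-data with the same coefficient and does not mix them, which
  makes each horizontal block a multiple of the identity.
\<close>

lemma block_xy_odd_insertion:
  assumes mask: "\<And>t. four_point \<omega> (\<lambda>s. if s = r then t else 0) = c * t"
  shows "block_xy (odd_insertion \<omega>) P r = c *\<^sub>R mat 1"
proof -
  have "(axis r (vector [a, b, 0]) :: real ^ 3 ^ 4) $ s $ 1 = (if s = r then a else 0)"
    and "(axis r (vector [a, b, 0]) :: real ^ 3 ^ 4) $ s $ 2 = (if s = r then b else 0)" for a b s
    by (simp_all add: axis_def)
  then show ?thesis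
    by (simp add: block_xy_def horizontal_frechet_derivative_odd_insertion
        horizontal_odd_insertion mask matrix_def mat_def axis_def vec_eq_iff forall_2)
qed

theorem corollary4p4:
  fixes \<omega> :: real
  assumes "\<omega> \<in> {0<..<1/8}"
  shows "(\<forall>P. odd_insertion \<omega> differentiable (at P))
    \<and> (\<forall>P. \<forall>r. block_z (odd_insertion \<omega>) P r = 0)
    \<and> (\<forall>P. block_xy (odd_insertion \<omega>) P (- 1) = (- \<omega>) *\<^sub>R mat 1
         \<and> block_xy (odd_insertion \<omega>) P 0 = (1/2 + \<omega>) *\<^sub>R mat 1
         \<and> block_xy (odd_insertion \<omega>) P 1 = (1/2 + \<omega>) *\<^sub>R mat 1
         \<and> block_xy (odd_insertion \<omega>) P 2 = (- \<omega>) *\<^sub>R mat 1)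
    \<and> (\<forall>P. \<forall>\<delta> :: real ^ 4.
         horizontal (odd_insertion \<omega> (\<chi> r. P $ r + vector [0, 0, \<delta> $ r]))
           = horizontal (odd_insertion \<omega> P))"
  by (intro conjI allI differentiable_odd_insertion block_z_odd_insertion block_xy_odd_insertion
      four_point_impulse)
    (simp add: horizontal_odd_insertion)

end
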